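(* Let $n\in\mathbb{N}$ and let $D\subseteq S_0$ be a $J$-set in $S_0$. Let $F$ be a finite nonempty set of $S_0$-preserving homomorphisms from $S_n$ into $S_0$. Then $$\{w\in S_n : (\forall \nu\in F)\,(\nu(w)\in D)\}$$ is a $J$-set in $S_n$.
   Context: $\mathbb{N}$ is the set of positive integers. $\mathcal{P}_f(X)$ is the set of nonempty finite subsets of $X$. $\mathbb{A}$ is a nonempty set (alphabet). $S_0$ is the set of all finite words $a_1a_2\cdots a_l$ with $l\ge 1$ and letters in $\mathbb{A}$; it is a semigroup under concatenation. For $n\in\mathbb{N}$, let $v_1,\ldots,v_n$ be distinct variables not in $\mathbb{A}$. $S_n$ is the set of $n$-variable words over $\mathbb{A}$, i.e. words over $\mathbb{A}\cup\{v_1,\ldots,v_n\}$ in which each $v_i$ ($1\le i\le n$) occurs at least once; it is a semigroup under concatenation. A homomorphism $\nu:S_n\to S_0$ is $S_0$-preserving if $\nu(uw)=u\,\nu(w)$ and $\nu(wu)=\nu(w)\,u$ for all $u\in S_0$, $w\in S_n$. $J$-set: let $(S,\cdot)$ be a semigroup, let ${}^{\mathbb{N}}S$ be the set of all sequences in $S$, and let $\mathcal{J}_m=\{(t_1,\ldots,t_m)\in\mathbb{N}^m : t_1<t_2<\cdots<t_m\}$. A set $A\subseteq S$ is a $J$-set (in $S$) if and only if for each $F\in\mathcal{P}_f({}^{\mathbb{N}}S)$ there exist $m\in\mathbb{N}$, $a=(a_1,\ldots,a_{m+1})\in S^{m+1}$ and $t=(t_1,\ldots,t_m)\in\mathcal{J}_m$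 such that for each $f\in F$, $\left(\prod_{j=1}^{m}a_j\cdot f(t_j)\right)\cdot a_{m+1}\in A$, where the product is taken in increasing order of indices. *)

theory Defs
  imports Main "HOL-Library.FuncSet"
begin

(* The product x 1 * x 2 * ... * x m (in increasing order of indices) for m >= 1;
   a semigroup has no unit, so m = 0 is meaningless and never used. *)
definition seq_prod :: "('s \<Rightarrow> 's \<Rightarrow> 's) \<Rightarrow> (nat \<Rightarrow> 's) \<Rightarrow> nat \<Rightarrow> 's" where
  "seq_prod mult x m = foldl mult (x 1) (map x [2..<Suc m])"

(* J-sets in the semigroup with carrier S and operation mult. Sequences are indexed by the
   positive integers; using the extensional function space, F is literally a finite
   nonempty set of sequences in S. *)
definition J_set :: "'s set \<Rightarrow> ('s \<Rightarrow> 's \<Rightarrow> 's) \<Rightarrow> 's set \<Rightarrow> bool" where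
  "J_set S mult A \<longleftrightarrow> A \<subseteq> S \<and>
    (\<forall>F :: (nat \<Rightarrow> 's) set. F \<noteq> {} \<and> finite F \<and> F \<subseteq> ({1..} \<rightarrow>\<^sub>E S) \<longrightarrow>
      (\<exists>m\<ge>1. \<exists>a \<in> {1..m + 1} \<rightarrow> S. \<exists>t \<in> {1..m} \<rightarrow> {1..}. strict_mono_on {1..m} t \<and>
        (\<forall>f\<in>F. mult (seq_prod mult (\<lambda>j. mult (a j) (f (t j))) m) (a (m + 1)) \<in> A)))"

datatype 'a symbol = Letter 'a | Var nat

(* The n-variable words over the alphabet A, with variables v_i = Var i for 1 <= i <= n.
   For n = 0 there are no variables, and this is the set S_0 of all nonempty finite words
   over A; S_0 and S_n thus share one ambient type and concatenate directly. *)
definition words :: "'a set \<Rightarrow> nat \<Rightarrow> 'a symbol list set" where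
  "words A n = {w. w \<noteq> [] \<and> set w \<subseteq> Letter ` A \<union> Var ` {1..n} \<and> Var ` {1..n} \<subseteq> set w}"

lemma words_0: "words A 0 = {map Letter u | u. u \<noteq> [] \<and> set u \<subseteq> A}"
proof (intro equalityI subsetI)
  fix w assume "w \<in> words A 0"
  then have w: "w \<noteq> []" "w \<in> lists (Letter ` A)" by (auto simp: words_def)
  then show "w \<in> {map Letter u | u. u \<noteq> [] \<and> set u \<subseteq> A}"
    by (auto simp: lists_image in_lists_conv_set)
qed (auto simp: words_def subset_iff)

lemma append_in_words: "u \<in> words A n \<Longrightarrow> w \<in> words A n \<Longrightarrow> u @ w \<in> words A n"
  by (auto simp: words_def)

lemma S0_append_in_words:
  "u \<in> words A 0 \<Longrightarrow> w \<in> words A n \<Longrightarrow> u @ w \<in> words A n \<and> w @ u \<in> words A n"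
  by (auto simp: words_def)

definition S0_preserving_homs ::
  "'a set \<Rightarrow> nat \<Rightarrow> ('a symbol list \<Rightarrow> 'a symbol list) set" where
  "S0_preserving_homs A n = {\<nu> \<in> words A n \<rightarrow>\<^sub>E words A 0.
     (\<forall>w\<in>words A n. \<forall>w'\<in>words A n. \<nu> (w @ w') = \<nu> w @ \<nu> w') \<and>
     (\<forall>u\<in>words A 0. \<forall>w\<in>words A n. \<nu> (u @ w) = u @ \<nu> w \<and> \<nu> (w @ u) = \<nu> w @ u)}"

end

theory Submission
  imports Defs
begin

text \<open>Fix any \<open>w \<in> S\<^sub>n\<close> and apply the \<open>J\<close>-set property of \<open>D\<close> to the sequences
  \<open>t \<mapsto> \<nu> (w g(t) w)\<close>, for \<open>\<nu> \<in> F\<close> and \<open>g\<close> in the given finite set. The resulting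
  coefficients \<open>b\<^sub>j \<in> S\<^sub>0\<close> do not depend on \<open>\<nu>\<close>, and since \<open>\<nu>\<close> preserves \<open>S\<^sub>0\<close> they can be
  pulled inside \<open>\<nu>\<close>; the factors \<open>w\<close> absorb them into the elements \<open>b\<^sub>1 w\<close>, \<open>w b\<^sub>j w\<close> and
  \<open>w b\<^sub>m\<^sub>+\<^sub>1\<close> of \<open>S\<^sub>n\<close>.\<close>

lemma seq_prod_1 [simp]: "seq_prod mult x (Suc 0) = x (Suc 0)"
  by (simp add: seq_prod_def)

lemma seq_prod_Suc: "m \<ge> 1 \<Longrightarrow> seq_prod mult x (Suc m) = mult (seq_prod mult x m) (x (Suc m))"
  by (simp add: seq_prod_def)

lemma S0_preserving_homsD:
  assumes "\<nu> \<in> S0_preserving_homs A n"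
  shows "w \<in> words A n \<Longrightarrow> \<nu> w \<in> words A 0"
    and "w \<in> words A n \<Longrightarrow> w' \<in> words A n \<Longrightarrow> \<nu> (w @ w') = \<nu> w @ \<nu> w'"
    and "u \<in> words A 0 \<Longrightarrow> w \<in> words A n \<Longrightarrow> \<nu> (u @ w) = u @ \<nu> w"
    and "u \<in> words A 0 \<Longrightarrow> w \<in> words A n \<Longrightarrow> \<nu> (w @ u) = \<nu> w @ u"
  using assms by (auto simp: S0_preserving_homs_def)

definition absorb :: "'a list \<Rightarrow> nat \<Rightarrow> (nat \<Rightarrow> 'a list) \<Rightarrow> nat \<Rightarrow> 'a list" where
  "absorb w m b j = (if j = 1 then [] else w) @ b j @ (if j = m + 1 then [] else w)"

text \<open>Since m \<ge> 1, the indices 1 and m + 1 differ, so at least one copy of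
  \<open>w\<close> survives next to \<open>b j\<close> and supplies all the variables.\<close>

lemma absorb_in_words:
  assumes "w \<in> words A n" "m \<ge> 1" "b j \<in> words A 0"
  shows "absorb w m b j \<in> words A n"
  using assms by (auto simp: absorb_def append_in_words S0_append_in_words)

text \<open>The partial product ends in \<open>x k\<close>, whose right-hand \<open>w\<close>
  belongs to the next coefficient. Appending \<open>w\<close> completes the block
  \<open>w @ x k @ w\<close>, so the word is a product of factors \<open>b j @ w @ x j @ w\<close>.
  The bound k \<le> m keeps the last coefficient, which has no right-hand \<open>w\<close>, out of
  the induction.\<close>

lemma hom_seq_prod_absorb:
  assumes \<nu>: "\<nu> \<in> S0_preserving_homs A n"
    and w: "w \<in> words A n"
    and b: "b \<in> {1..m} \<rightarrow> words A 0"
    and x: "x \<in> {1..m} \<rightarrow> words A n"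
    and k: "1 \<le> k" "k \<le> m"
  shows "seq_prod (@) (\<lambda>j. absorb w m b j @ x j) k \<in> words A n \<and>
    \<nu> (seq_prod (@) (\<lambda>j. absorb w m b j @ x j) k @ w) = seq_prod (@) (\<lambda>j. b j @ \<nu> (w @ x j @ w)) k"
  using k
proof (induction k rule: nat_induct_at_least)
  case base
  then have "b 1 \<in> words A 0" "x 1 \<in> words A n"
    using b x by auto
  with base w show ?case
    by (simp add: absorb_def append_in_words S0_append_in_words S0_preserving_homsD(3)[OF \<nu>])
next
  case (Suc k)
  let ?P = "seq_prod (@) (\<lambda>j. absorb w m b j @ x j) k"
  have bx: "b (Suc k) \<in> words A 0" "x (Suc k) \<in> words A n"
    using b x Suc.prems by auto
  have P: "?P \<in> words A n"
    "\<nu> (?P @ w) = seq_prod (@) (\<lambda>j. b j @ \<nu> (w @ x j @ w)) k"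
    using Suc by auto
  \<comment> \<open>The appended \<open>w\<close> of the induction hypothesis serves as the left
    \<open>w\<close> of coefficient \<open>Suc k\<close>. Multiplicativity splits the word there,
    and preservation of \<open>S_0\<close> pulls out \<open>b (Suc k)\<close>.\<close>
  have "\<nu> ((?P @ w) @ (b (Suc k) @ (w @ x (Suc k) @ w)))
      = \<nu> (?P @ w) @ (b (Suc k) @ \<nu> (w @ x (Suc k) @ w))"
    using P(1) bx w by (simp only: S0_preserving_homsD(2,3)[OF \<nu>] append_in_words S0_append_in_words)
  moreover have "?P @ w @ b (Suc k) @ w @ x (Suc k) \<in> words A n"
    using P(1) bx w by (simp add: append_in_words S0_append_in_words)
  ultimately show ?case
    using P(2) Suc.hyps Suc.prems by (simp add: seq_prod_Suc absorb_def)
qed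

theorem theorem2p9:
  fixes A :: "'a set" and n :: nat and D :: "'a symbol list set"
    and F :: "('a symbol list \<Rightarrow> 'a symbol list) set"
  assumes "A \<noteq> {}" and "n \<ge> 1"
    and "J_set (words A 0) (@) D"
    and "finite F" and "F \<noteq> {}" and "F \<subseteq> S0_preserving_homs A n"
  shows "J_set (words A n) (@) {w \<in> words A n. \<forall>\<nu>\<in>F. \<nu> w \<in> D}"
  unfolding J_set_def
proof (intro conjI allI impI, goal_cases)
  case 1
  show ?case by auto
next
  case (2 G)
  \<comment> \<open>Any value of a sequence in the nonempty set \<open>G\<close> can serve as
    \<open>w\<close>.\<close>
  then obtain g0 where "g0 \<in> G" by auto
  with 2 have "g0 1 \<in> words A n" by auto
  then obtain w where w: "w \<in> words A n" ..
  define H where "H = (\<lambda>(\<nu>, g). \<lambda>t\<in>{1..}. \<nu> (w @ g t @ w)) ` (F \<times> G)"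
  have "H \<noteq> {} \<and> finite H"
    using 2 assms by (auto simp: H_def)
  moreover have "H \<subseteq> {1..} \<rightarrow>\<^sub>E words A 0"
  proof -
    have "\<nu> (w @ g t @ w) \<in> words A 0" if "\<nu> \<in> F" "g \<in> G" "t \<ge> 1" for \<nu> g t
    proof -
      have "g t \<in> words A n" using 2 that by auto
      then show ?thesis
        using w that assms(6) by (blast intro: S0_preserving_homsD(1) append_in_words)
    qed
    then show ?thesis unfolding H_def image_subset_iff by (simp add: restrict_PiE_iff)
  qed
  ultimately have H: "H \<noteq> {} \<and> finite H \<and> H \<subseteq> {1..} \<rightarrow>\<^sub>E words A 0"
    by simp
  obtain m b t where m: "m \<ge> 1" and b: "b \<in> {1..m + 1} \<rightarrow> words A 0"
    and t: "t \<in> {1..m} \<rightarrow> {1..}" "strict_mono_on {1..m} t"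
    and D: "\<And>f. f \<in> H \<Longrightarrow> seq_prod (@) (\<lambda>j. b j @ f (t j)) m @ b (m + 1) \<in> D"
    using assms(3)[unfolded J_set_def, THEN conjunct2, rule_format, OF H] by blast
  let ?a = "absorb w m b"
  have a: "?a \<in> {1..m + 1} \<rightarrow> words A n"
    using b m w by (auto intro!: absorb_in_words)
  have "seq_prod (@) (\<lambda>j. ?a j @ g (t j)) m @ ?a (m + 1) \<in> {w \<in> words A n. \<forall>\<nu>\<in>F. \<nu> w \<in> D}"
    if g: "g \<in> G" for g
  proof -
    let ?P = "seq_prod (@) (\<lambda>j. ?a j @ g (t j)) m"
    have gt: "(\<lambda>j. g (t j)) \<in> {1..m} \<rightarrow> words A n"
      using 2 g t(1) by (force simp: PiE_def Pi_def)
    have b': "b \<in> {1..m} \<rightarrow> words A 0" and bm: "b (m + 1) \<in> words A 0"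
      using b by auto
    \<comment> \<open>The last coefficient is \<open>w @ b (m + 1)\<close>: its \<open>w\<close>
      closes the final block, and \<open>b (m + 1)\<close> can then leave \<nu> on the
      right.\<close>
    have eq: "?P @ ?a (m + 1) = (?P @ w) @ b (m + 1)"
      using m by (simp add: absorb_def)
    have "?P \<in> words A n \<and> \<nu> (?P @ ?a (m + 1)) \<in> D" if \<nu>: "\<nu> \<in> F" for \<nu>
    proof -
      have hom: "\<nu> \<in> S0_preserving_homs A n" using \<nu> assms(6) by auto
      note P = hom_seq_prod_absorb[OF hom w b' gt m order_refl]
      \<comment> \<open>All \<open>t j\<close> with j in \<open>{1..m}\<close> are positive, so the
        restriction that makes the members of \<open>H\<close> extensional evaluates away.\<close>
      have "seq_prod (@) (\<lambda>j. b j @ (\<lambda>t\<in>{1..}. \<nu> (w @ g t @ w)) (t j)) m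
          = seq_prod (@) (\<lambda>j. b j @ \<nu> (w @ g (t j) @ w)) m"
        unfolding seq_prod_def using t(1) m
        by (intro foldl_cong) (auto simp: Pi_def simp del: upt_Suc)
      moreover have "(\<lambda>t\<in>{1..}. \<nu> (w @ g t @ w)) \<in> H"
        using \<nu> g by (auto simp: H_def)
      then have "seq_prod (@) (\<lambda>j. b j @ (\<lambda>t\<in>{1..}. \<nu> (w @ g t @ w)) (t j)) m @ b (m + 1) \<in> D"
        by (rule D)
      ultimately have "seq_prod (@) (\<lambda>j. b j @ \<nu> (w @ g (t j) @ w)) m @ b (m + 1) \<in> D"
        by (simp only:)
      moreover have "\<nu> ((?P @ w) @ b (m + 1)) = \<nu> (?P @ w) @ b (m + 1)"
        using P w bm by (intro S0_preserving_homsD(4)[OF hom] append_in_words) auto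
      ultimately show ?thesis using P unfolding eq by (simp only: simp_thms)
    qed
    moreover have "?a (m + 1) \<in> words A n" using a by auto
    \<comment> \<open>Membership of \<open>?P\<close> in \<open>words A n\<close> was obtained for
      each \<nu> in \<open>F\<close>; nonemptiness of \<open>F\<close> releases it.\<close>
    ultimately show ?thesis using assms(5) append_in_words[of ?P A n] by auto
  qed
  then show ?case
    by (intro exI[of _ m] conjI[OF m] bexI[OF _ a] bexI[OF _ t(1)] conjI[OF t(2)] ballI)
qed

end
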